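(* For all integers $n\ge 0$, $$F_{n+3}^2-1=\sum_{k=0}^n\left\{3F_{k+1}^2+2\sum_{i=1}^kF_i^2\right\}.$$
   Context: The Fibonacci numbers are $F_0=0$, $F_1=1$, $F_n=F_{n-1}+F_{n-2}$ for $n\ge2$. Empty sums are $0$. *)

theory Defs
  imports "HOL-Number_Theory.Fib"
begin

end

theory Submission
  imports Defs
begin

text \<open>By \<open>sum_fib_squares\<close> the summand is F_{k+1}(3F_{k+1} + 2F_k). This equals
  (F_{k+3} - F_{k+2})(F_{k+3} + F_{k+2}), so the sum telescopes to F_{n+3}^2 - F_2^2, and F_2 =
  1.\<close>

lemma sum_fib_squares:
  "(\<Sum>i = 1..k. (int (fib i))\<^sup>2) = int (fib k) * int (fib (k + 1))"
  by (induction k) (auto simp: power2_eq_square algebra_simps)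

theorem mainTheorem3:
  fixes n :: nat
  shows "(int (fib (n + 3)))\<^sup>2 - 1 =
    (\<Sum>k = 0..n. 3 * (int (fib (k + 1)))\<^sup>2 + 2 * (\<Sum>i = 1..k. (int (fib i))\<^sup>2))"
  unfolding sum_fib_squares
proof (induction n)
  case 0
  show ?case by (simp add: numeral_3_eq_3)
next
  case (Suc n)
  \<comment> \<open>The new summand is F_{n+4}^2 - F_{n+3}^2; the recurrence reduces this to a
    polynomial identity in F_n and F_{n+1}.\<close>
  then show ?case
    by (simp add: numeral_3_eq_3 power2_eq_square algebra_simps)
qed

end
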